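(* Let $X$ be a complete CAT(0) space, $C\subseteq X$ a convex subset, $T:C\to C$ a nonexpansive mapping with a fixed point, $u,x_0\in C$, and let $(\beta_n)_{n\in\mathbb N},(\lambda_n)_{n\in\mathbb N}$ be sequences in $[0,1]$ such that $$\sum_{n=0}^\infty(1-\beta_n)=\infty,\quad\sum_{n=0}^\infty|\beta_{n+1}-\beta_n|<\infty,\quad\sum_{n=0}^\infty|\lambda_{n+1}-\lambda_n|<\infty,\quad\lim_{n\to\infty}\beta_n=1,\quad\liminf_{n\to\infty}\lambda_n>0.$$ Then the Tikhonov-Mann iteration $(x_n)$ defined by $$x_{n+1}=(1-\lambda_n)u_n+\lambda_nTu_n,\qquad u_n=(1-\beta_n)u+\beta_nx_n\qquad(n\in\mathbb N)$$ converges strongly (i.e. in the metric of $X$).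
   Context: In a CAT(0) space $(X,d)$, which is uniquely geodesic, $(1-\lambda)x+\lambda y$ denotes, for $x,y\in X$ and $\lambda\in[0,1]$, the unique point $z\in X$ with $d(x,z)=\lambda d(x,y)$ and $d(y,z)=(1-\lambda)d(x,y)$. A nonempty $C\subseteq X$ is convex if $(1-\lambda)x+\lambda y\in C$ for all $x,y\in C$, $\lambda\in[0,1]$. $T$ is nonexpansive if $d(Tx,Ty)\le d(x,y)$ for all $x,y\in C$. *)

theory Defs
  imports "HOL-Analysis.Analysis"
begin

definition geodesic_path :: "(real \<Rightarrow> 'a::metric_space) \<Rightarrow> 'a \<Rightarrow> 'a \<Rightarrow> bool" where
  "geodesic_path c x y \<longleftrightarrow> c 0 = x \<and> c (dist x y) = y \<and>
     (\<forall>s\<in>{0..dist x y}. \<forall>t\<in>{0..dist x y}. dist (c s) (c t) = \<bar>s - t\<bar>)"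

definition geodesic_segment :: "'a::metric_space set \<Rightarrow> 'a \<Rightarrow> 'a \<Rightarrow> bool" where
  "geodesic_segment S x y \<longleftrightarrow> (\<exists>c. geodesic_path c x y \<and> S = c ` {0..dist x y})"

definition geodesic_triangle ::
    "'a::metric_space \<Rightarrow> 'a \<Rightarrow> 'a \<Rightarrow> 'a set \<Rightarrow> 'a set \<Rightarrow> 'a set \<Rightarrow> bool" where
  "geodesic_triangle p q r P Q R \<longleftrightarrow>
     geodesic_segment P p q \<and> geodesic_segment Q q r \<and> geodesic_segment R r p"

definition comparison_triangle ::
    "'a::metric_space \<Rightarrow> 'a \<Rightarrow> 'a \<Rightarrow> real^2 \<Rightarrow> real^2 \<Rightarrow> real^2 \<Rightarrow> bool" where
  "comparison_triangle p q r p' q' r' \<longleftrightarrow>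
     dist p' q' = dist p q \<and> dist q' r' = dist q r \<and> dist r' p' = dist r p"

text \<open>A point of a geodesic triangle and a corresponding point on the same side of a comparison
  triangle. A point lying on several sides (e.g. a vertex) is considered with respect to each.\<close>

definition comparison_point ::
    "'a::metric_space \<Rightarrow> 'a \<Rightarrow> 'a \<Rightarrow> 'a set \<Rightarrow> 'a set \<Rightarrow> 'a set \<Rightarrow>
     real^2 \<Rightarrow> real^2 \<Rightarrow> real^2 \<Rightarrow> 'a \<Rightarrow> real^2 \<Rightarrow> bool" where
  "comparison_point p q r P Q R p' q' r' x x' \<longleftrightarrow>
     (x \<in> P \<and> x' \<in> closed_segment p' q' \<and> dist p' x' = dist p x) \<or>
     (x \<in> Q \<and> x' \<in> closed_segment q' r' \<and> dist q' x' = dist q x) \<or>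
     (x \<in> R \<and> x' \<in> closed_segment r' p' \<and> dist r' x' = dist r x)"

class cat0_space = metric_space +
  assumes geodesic_segment_exists: "\<exists>S. geodesic_segment S x y"
    and cat0_inequality:
      "geodesic_triangle p q r P Q R \<Longrightarrow>
       comparison_triangle p q r p' q' r' \<Longrightarrow>
       comparison_point p q r P Q R p' q' r' x x' \<Longrightarrow>
       comparison_point p q r P Q R p' q' r' y y' \<Longrightarrow>
       dist x y \<le> dist x' y'"

text \<open>\<open>geodesic_comb t x y\<close> is the point written $(1-t)x + ty$.  The description is well defined
  in CAT(0) spaces for \<open>t \<in> {0..1}\<close>.\<close>

definition geodesic_comb :: "real \<Rightarrow> 'a::metric_space \<Rightarrow> 'a \<Rightarrow> 'a" where
  "geodesic_comb t x y = (THE z. dist x z = t * dist x y \<and> dist y z = (1 - t) * dist x y)"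

definition geodesically_convex :: "'a::metric_space set \<Rightarrow> bool" where
  "geodesically_convex C \<longleftrightarrow>
     C \<noteq> {} \<and> (\<forall>x\<in>C. \<forall>y\<in>C. \<forall>t\<in>{0..1}. geodesic_comb t x y \<in> C)"

definition nonexpansive_on :: "'a::metric_space set \<Rightarrow> ('a \<Rightarrow> 'a) \<Rightarrow> bool" where
  "nonexpansive_on C T \<longleftrightarrow> (\<forall>x\<in>C. \<forall>y\<in>C. dist (T x) (T y) \<le> dist x y)"

primrec tikhonov_mann ::
    "('a::metric_space \<Rightarrow> 'a) \<Rightarrow> 'a \<Rightarrow> 'a \<Rightarrow> (nat \<Rightarrow> real) \<Rightarrow> (nat \<Rightarrow> real) \<Rightarrow> nat \<Rightarrow> 'a" where
  "tikhonov_mann T u x0 \<beta> \<mu> 0 = x0"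
| "tikhonov_mann T u x0 \<beta> \<mu> (Suc n) =
     (let v = geodesic_comb (\<beta> n) u (tikhonov_mann T u x0 \<beta> \<mu> n)
      in geodesic_comb (\<mu> n) v (T v))"

end

(* Comparison with the Euclidean plane gives the CN inequality for
   d^2((1-t)x + ty, w) and convexity of the metric. Convexity yields asymptotic
   regularity d(x_{n+1}, x_n) -> 0, whence d(u_n, T u_n) -> 0 because the lambda_n
   stay away from 0. Instead of projecting u onto Fix T (C need not be closed) or
   using resolvents, let r be the supremum over delta > 0 of the infimum of d^2(u, y)
   over the bounded delta-almost fixed points y in C. The CN inequality shows that
   midpoints of almost fixed points are almost fixed, so almost minimisers form a Cauchy
   sequence. Its limit z satisfies d^2(u, z) <= r, d(Tx, z) <= d(x, z) on C, and
   liminf d^2(u, u_n) >= r by the choice of r. The CN inequality gives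
     d^2(x_{n+1}, z) <= beta_n d^2(x_n, z)
                        + (1 - beta_n) (d^2(u, z) - beta_n d^2(u, x_n)),
   where beta_n d^2(u, x_n) >= d^2(u, u_n), so that x_n -> z.
   In the proofs the points u_n are called v n. *)

theory Submission
  imports Defs
begin

section \<open>Comparison triangles and the CN inequality\<close>

text \<open>Put \<open>p'\<close> at the origin and \<open>q'\<close> on the first axis; the law of
  cosines then dictates the coordinates \<open>x\<close>, \<open>y\<close> of \<open>r'\<close>.
  Solving for \<open>x\<close> divides by \<open>dist p q\<close>, hence the separate case
  \<open>p = q\<close>.\<close>

lemma comparison_triangle_exists:
  fixes p q r :: "'a::metric_space"
  obtains p' q' r' where "comparison_triangle p q r p' q' r'"
proof (cases "p = q")
  case True
  have "comparison_triangle p q r 0 0 (dist q r *\<^sub>R axis 1 1)"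
    using True by (simp add: comparison_triangle_def dist_norm norm_axis_1 dist_commute)
  then show ?thesis by (rule that)
next
  case False
  define a b c where "a = dist p q" and "b = dist r p" and "c = dist q r"
  have a: "a > 0" using False by (simp add: a_def)
  have nonneg: "b \<ge> 0" "c \<ge> 0" by (simp_all add: b_def c_def)
  have tri: "b \<le> a + c" "c \<le> a + b" "a \<le> b + c"
    unfolding a_def b_def c_def by metric+
  define x where "x = (a\<^sup>2 + b\<^sup>2 - c\<^sup>2) / (2 * a)"
  define y where "y = sqrt (b\<^sup>2 - x\<^sup>2)"
  have x: "2 * a * x = a\<^sup>2 + b\<^sup>2 - c\<^sup>2"
    using a by (simp add: x_def)
  \<comment> \<open>Up to the factor \<open>2 * a\<close> this is
    \<open>\<bar>x\<bar> \<le> b\<close>, which makes the radicand in \<open>y\<close> nonnegative.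
    It amounts to \<open>\<bar>a - b\<bar> \<le> c \<le> a + b\<close>.\<close>
  have "(2 * a * x)\<^sup>2 \<le> (2 * a * b)\<^sup>2"
  proof (rule abs_le_square_iff[THEN iffD1])
    have "c\<^sup>2 \<le> (a + b)\<^sup>2" using tri nonneg by (intro power_mono) auto
    moreover have "\<bar>a - b\<bar>\<^sup>2 \<le> c\<^sup>2" using tri nonneg by (intro power_mono) auto
    ultimately show "\<bar>2 * a * x\<bar> \<le> \<bar>2 * a * b\<bar>"
      unfolding x using a nonneg by (simp add: power2_eq_square algebra_simps)
  qed
  then have "x\<^sup>2 \<le> b\<^sup>2" using a by (simp add: power_mult_distrib)
  then have y: "y\<^sup>2 = b\<^sup>2 - x\<^sup>2" by (simp add: y_def)
  define q' r' :: "real^2" where "q' = vector [a, 0]" and "r' = vector [x, y]"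
  have "dist 0 q' = a"
    using a by (simp add: q'_def dist_norm norm_vec_def L2_set_def sum_2)
  moreover have "dist q' r' = c"
  proof -
    have "(a - x)\<^sup>2 + y\<^sup>2 = c\<^sup>2"
      unfolding y using x by (simp add: power2_eq_square algebra_simps)
    then show ?thesis
      using nonneg by (simp add: q'_def r'_def dist_vec_def L2_set_def sum_2 dist_real_def)
  qed
  moreover have "dist r' 0 = b"
    using nonneg y by (simp add: r'_def dist_norm norm_vec_def L2_set_def sum_2)
  ultimately have "comparison_triangle p q r 0 q' r'"
    by (simp add: comparison_triangle_def a_def b_def c_def)
  then show ?thesis by (rule that)
qed

text \<open>Stewart's theorem, by expanding inner products: the Euclidean equality from which
  comparison produces the CN inequality.\<close>

lemma stewart_identity:
  fixes x y w :: "'a::real_inner"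
  shows "(dist ((1 - t) *\<^sub>R x + t *\<^sub>R y) w)\<^sup>2 =
    (1 - t) * (dist x w)\<^sup>2 + t * (dist y w)\<^sup>2 - t * (1 - t) * (dist x y)\<^sup>2"
  unfolding dist_norm power2_norm_eq_inner
  by (simp add: inner_simps inner_commute algebra_simps power2_eq_square)

lemma geodesic_segment_point:
  assumes "geodesic_segment S x y" "t \<in> {0..1}"
  obtains z where "z \<in> S" "dist x z = t * dist x y" "dist y z = (1 - t) * dist x y"
proof -
  obtain c where c: "geodesic_path c x y" and S: "S = c ` {0..dist x y}"
    using assms(1) by (auto simp: geodesic_segment_def)
  have *: "t * dist x y \<in> {0..dist x y}"
    using assms(2) by (simp add: mult_left_le_one_le)
  let ?z = "c (t * dist x y)"
  have path: "dist (c s) (c s') = \<bar>s - s'\<bar>" if "s \<in> {0..dist x y}" "s' \<in> {0..dist x y}" for s s'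
    using c that unfolding geodesic_path_def by blast
  have "dist (c 0) ?z = t * dist x y"
    using path[of 0, OF _ *] assms(2) by (simp add: abs_mult)
  moreover have "dist (c (dist x y)) ?z = (1 - t) * dist x y"
    using path[of "dist x y", OF _ *] * by (simp add: algebra_simps)
  ultimately show ?thesis
    using that[of ?z] * S c by (auto simp: geodesic_path_def)
qed

text \<open>Compare the distance from \<open>z\<close> to the opposite vertex \<open>w\<close> with
  its Euclidean counterpart and apply \<open>stewart_identity\<close>. The form with an explicit
  segment comes first because the uniqueness behind \<open>geodesic_comb\<close> is deduced from
  it.\<close>

lemma geodesic_segment_cn_inequality:
  fixes x y z w :: "'a::cat0_space"
  assumes "geodesic_segment S x y" "z \<in> S" "dist x z = t * dist x y" "t \<in> {0..1}"
  shows "(dist z w)\<^sup>2 \<le>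
    (1 - t) * (dist x w)\<^sup>2 + t * (dist y w)\<^sup>2 - t * (1 - t) * (dist x y)\<^sup>2"
proof -
  obtain Q R where "geodesic_segment Q y w" and R: "geodesic_segment R w x"
    using geodesic_segment_exists by metis
  then have tri: "geodesic_triangle x y w S Q R"
    using assms(1) by (simp add: geodesic_triangle_def)
  obtain x' y' w' where cmp: "comparison_triangle x y w x' y' w'"
    by (rule comparison_triangle_exists)
  let ?z = "(1 - t) *\<^sub>R x' + t *\<^sub>R y'"
  have d: "dist x' y' = dist x y" "dist y' w' = dist y w" "dist x' w' = dist x w"
    using cmp by (simp_all add: comparison_triangle_def dist_commute)
  have "dist x' ?z = t * dist x' y'"
  proof -
    have "x' - ?z = t *\<^sub>R (x' - y')" by (simp add: algebra_simps)
    then show ?thesis using assms(4) by (simp add: dist_norm)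
  qed
  then have z: "comparison_point x y w S Q R x' y' w' z ?z"
    using assms d by (auto simp: comparison_point_def in_segment)
  have "w \<in> R" using geodesic_segment_point[OF R, of 0] by (metis atLeastAtMost_iff
      dist_eq_0_iff mult_zero_left order_refl zero_le_one)
  then have w: "comparison_point x y w S Q R x' y' w' w w'"
    by (simp add: comparison_point_def)
  have "dist z w \<le> dist ?z w'" by (rule cat0_inequality[OF tri cmp z w])
  then have "(dist z w)\<^sup>2 \<le> (dist ?z w')\<^sup>2" by (intro power_mono) auto
  then show ?thesis by (simp only: stewart_identity d)
qed

section \<open>Geodesic combinations and convexity of the metric\<close>

text \<open>The candidates are not assumed to lie on a geodesic segment. Each is compared with a
  point \<open>m\<close> that does: for a candidate \<open>a\<close> the right side of the CN
  inequality for \<open>dist m a\<close> vanishes, so \<open>a = m\<close>.\<close>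

lemma geodesic_comb_unique:
  fixes x y z z' :: "'a::cat0_space"
  assumes "t \<in> {0..1}"
    and z: "dist x z = t * dist x y" "dist y z = (1 - t) * dist x y"
    and z': "dist x z' = t * dist x y" "dist y z' = (1 - t) * dist x y"
  shows "z = z'"
proof -
  obtain S where S: "geodesic_segment S x y" using geodesic_segment_exists by blast
  obtain m where m: "m \<in> S" "dist x m = t * dist x y" using geodesic_segment_point S assms(1) .
  have "m = a" if a: "dist x a = t * dist x y" "dist y a = (1 - t) * dist x y" for a
  proof -
    have "(dist m a)\<^sup>2 \<le> (1 - t) * (dist x a)\<^sup>2 + t * (dist y a)\<^sup>2 - t * (1 - t) * (dist x y)\<^sup>2"
      using geodesic_segment_cn_inequality[OF S m assms(1)] .
    also have "\<dots> = 0" unfolding a by (simp add: power2_eq_square algebra_simps)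
    finally show ?thesis by simp
  qed
  then show ?thesis using z z' by metis
qed

lemma geodesic_comb_eqI:
  fixes x y z :: "'a::cat0_space"
  assumes "t \<in> {0..1}" "dist x z = t * dist x y" "dist y z = (1 - t) * dist x y"
  shows "geodesic_comb t x y = z"
  unfolding geodesic_comb_def using assms geodesic_comb_unique by blast

lemma geodesic_comb_mem_segment:
  fixes x y :: "'a::cat0_space"
  assumes "geodesic_segment S x y" "t \<in> {0..1}"
  shows "geodesic_comb t x y \<in> S"
  using geodesic_segment_point[OF assms] geodesic_comb_eqI[OF assms(2)] by metis

lemma
  fixes x y :: "'a::cat0_space"
  assumes "t \<in> {0..1}"
  shows dist_geodesic_comb_left: "dist x (geodesic_comb t x y) = t * dist x y"
    and dist_geodesic_comb_right: "dist y (geodesic_comb t x y) = (1 - t) * dist x y"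
  using geodesic_segment_exists[of x y] geodesic_segment_point[OF _ assms]
    geodesic_comb_eqI[OF assms] by metis+

lemma cn_inequality:
  fixes x y w :: "'a::cat0_space"
  assumes "t \<in> {0..1}"
  shows "(dist (geodesic_comb t x y) w)\<^sup>2 \<le>
    (1 - t) * (dist x w)\<^sup>2 + t * (dist y w)\<^sup>2 - t * (1 - t) * (dist x y)\<^sup>2"
  using geodesic_segment_exists[of x y] geodesic_segment_cn_inequality
    geodesic_comb_mem_segment dist_geodesic_comb_left assms by metis

lemma geodesic_comb_swap:
  fixes x y :: "'a::cat0_space"
  assumes "t \<in> {0..1}"
  shows "geodesic_comb (1 - t) y x = geodesic_comb t x y"
  using assms by (intro geodesic_comb_eqI)
    (simp_all add: dist_geodesic_comb_left dist_geodesic_comb_right dist_commute)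

lemma geodesic_comb_same [simp]:
  fixes x :: "'a::cat0_space"
  assumes "t \<in> {0..1}"
  shows "geodesic_comb t x x = x"
  using assms by (intro geodesic_comb_eqI) simp_all

text \<open>With the second combination as the reference point, the right side of the CN inequality
  collapses to a perfect square, since \<open>(1 - s) * t\<^sup>2 + s * (1 - t)\<^sup>2 - s * (1 -
  s) = (s - t)\<^sup>2\<close>.\<close>

lemma dist_geodesic_comb_param_le:
  fixes x y :: "'a::cat0_space"
  assumes "s \<in> {0..1}" "t \<in> {0..1}"
  shows "dist (geodesic_comb s x y) (geodesic_comb t x y) \<le> \<bar>s - t\<bar> * dist x y"
proof -
  have "(dist (geodesic_comb s x y) (geodesic_comb t x y))\<^sup>2 \<le>
     (1 - s) * (t * dist x y)\<^sup>2 + s * ((1 - t) * dist x y)\<^sup>2 - s * (1 - s) * (dist x y)\<^sup>2"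
    using cn_inequality[OF assms(1), of x y "geodesic_comb t x y"]
    by (simp only: dist_geodesic_comb_left[OF assms(2)] dist_geodesic_comb_right[OF assms(2)])
  also have "\<dots> = (\<bar>s - t\<bar> * dist x y)\<^sup>2"
    by (simp add: power_mult_distrib) (simp add: power2_eq_square algebra_simps)
  finally show ?thesis by (rule power2_le_imp_le) simp
qed

text \<open>In the comparison triangle the two points divide the sides at \<open>x'\<close> in the
  same ratio, so by similarity their distance is exactly \<open>t * dist y' z'\<close>. As they lie
  on different sides, the CAT(0) inequality is used in its general form.\<close>

lemma dist_geodesic_comb_right_le:
  fixes x y z :: "'a::cat0_space"
  assumes t: "t \<in> {0..1}"
  shows "dist (geodesic_comb t x y) (geodesic_comb t x z) \<le> t * dist y z"
proof -
  obtain P Q R where segs: "geodesic_segment P x y" "geodesic_segment Q y z" "geodesic_segment R z x"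
    using geodesic_segment_exists by metis
  then have tri: "geodesic_triangle x y z P Q R" by (simp add: geodesic_triangle_def)
  obtain x' y' z' where cmp: "comparison_triangle x y z x' y' z'"
    by (rule comparison_triangle_exists)
  then have d: "dist x' y' = dist x y" "dist y' z' = dist y z" "dist z' x' = dist x z"
    by (simp_all add: comparison_triangle_def dist_commute)
  let ?a = "(1 - t) *\<^sub>R x' + t *\<^sub>R y'" and ?b = "(1 - t) *\<^sub>R x' + t *\<^sub>R z'"
  have "x' - ?a = t *\<^sub>R (x' - y')" "z' - ?b = (1 - t) *\<^sub>R (z' - x')" "?a - ?b = t *\<^sub>R (y' - z')"
    by (simp_all add: algebra_simps)
  then have ab: "dist x' ?a = t * dist x' y'" "dist z' ?b = (1 - t) * dist z' x'"
      "dist ?a ?b = t * dist y' z'"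
    using t by (simp_all add: dist_norm)
  \<comment> \<open>The third side runs from \<open>z\<close> to \<open>x\<close>, so points on it
    are measured from \<open>z\<close>, with parameter \<open>1 - t\<close>.\<close>
  have "?b \<in> closed_segment z' x'"
    using t by (subst closed_segment_commute) (auto simp: in_segment)
  moreover have "geodesic_comb t x z \<in> R"
    using geodesic_comb_mem_segment[OF segs(3), of "1 - t"] t by (simp add: geodesic_comb_swap)
  ultimately have "comparison_point x y z P Q R x' y' z' (geodesic_comb t x z) ?b"
    using ab t by (simp add: comparison_point_def d dist_geodesic_comb_right)
  moreover have "comparison_point x y z P Q R x' y' z' (geodesic_comb t x y) ?a"
    using ab t geodesic_comb_mem_segment[OF segs(1) t]
    by (auto simp: comparison_point_def d dist_geodesic_comb_left in_segment)
  ultimately show ?thesis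
    using cat0_inequality[OF tri cmp] ab d by metis
qed

text \<open>The endpoints are moved one at a time, through \<open>geodesic_comb t x y'\<close>.
  Swapping the two endpoints reduces the move of the left one to that of the right one.\<close>

lemma dist_geodesic_comb_le:
  fixes x y x' y' :: "'a::cat0_space"
  assumes t: "t \<in> {0..1}"
  shows "dist (geodesic_comb t x y) (geodesic_comb t x' y') \<le> (1 - t) * dist x x' + t * dist y y'"
proof -
  have "dist (geodesic_comb (1 - t) y' x) (geodesic_comb (1 - t) y' x') \<le> (1 - t) * dist x x'"
    using t by (intro dist_geodesic_comb_right_le) simp
  then have "dist (geodesic_comb t x y') (geodesic_comb t x' y') \<le> (1 - t) * dist x x'"
    by (simp only: geodesic_comb_swap[OF t])
  then show ?thesis
    using dist_geodesic_comb_right_le[OF t, of x y y']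
      dist_triangle[of "geodesic_comb t x y" "geodesic_comb t x' y'" "geodesic_comb t x y'"]
    by linarith
qed

lemma dist_geodesic_comb_point_le:
  fixes x y w :: "'a::cat0_space"
  assumes "t \<in> {0..1}"
  shows "dist (geodesic_comb t x y) w \<le> (1 - t) * dist x w + t * dist y w"
  using dist_geodesic_comb_le[OF assms, of x y w w] assms by simp

section \<open>A recursive inequality for real sequences\<close>

text \<open>Once \<open>b n \<le> d\<close>, each step averages the old value with something at most
  \<open>d\<close>, up to the error \<open>c n\<close>. The initial excess is damped by the product
  of the factors \<open>1 - a k\<close>, which divergence of the sum of the \<open>a k\<close>
  forces to 0. Only the upper limit of \<open>b\<close> is controlled, as \<open>b\<close> may be
  negative in the application.\<close>

lemma xu_recursive_inequality:
  fixes s a b c :: "nat \<Rightarrow> real"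
  assumes s: "\<And>n. 0 \<le> s n"
    and a: "\<And>n. a n \<in> {0..1}"
    and rec: "\<And>n. s (Suc n) \<le> (1 - a n) * s n + a n * b n + c n"
    and div: "filterlim (\<lambda>N. \<Sum>n<N. a n) at_top sequentially"
    and b: "\<And>e. 0 < e \<Longrightarrow> eventually (\<lambda>n. b n \<le> e) sequentially"
    and c: "\<And>n. 0 \<le> c n" "summable c"
  shows "s \<longlonglongrightarrow> 0"
proof (rule LIMSEQ_I)
  fix e :: real assume "0 < e"
  \<comment> \<open>The final bound has three terms, each at most \<open>d\<close>, and
    \<open>3 * d < e\<close>.\<close>
  define d where "d = e / 4"
  have d: "d > 0" using \<open>0 < e\<close> by (simp add: d_def)
  obtain N1 where N1: "\<And>n. n \<ge> N1 \<Longrightarrow> b n \<le> d"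
    using b[OF d] by (auto simp: eventually_sequentially)
  obtain N2 where N2: "\<And>m n. m \<ge> N2 \<Longrightarrow> norm (sum c {m..<n}) < d"
    using c(2) d unfolding summable_Cauchy by blast
  define N where "N = max N1 N2"
  have bound: "s n \<le> d + exp (- (\<Sum>k=N..<n. a k)) * s N + (\<Sum>k=N..<n. c k)" if "n \<ge> N" for n
    using that
  proof (induction n rule: dec_induct)
    case base
    then show ?case using d by simp
  next
    case (step n)
    let ?E = "exp (- (\<Sum>k=N..<n. a k)) * s N" and ?S = "\<Sum>k=N..<n. c k"
    have "1 - a n \<le> exp (- a n)" using exp_ge_add_one_self[of "- a n"] by simp
    then have E: "(1 - a n) * ?E \<le> exp (- a n) * ?E"
      using s by (intro mult_right_mono) auto
    have S: "(1 - a n) * ?S \<le> ?S"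
      using a[of n] c(1) by (intro mult_left_le_one_le sum_nonneg) auto
    have "s (Suc n) \<le> (1 - a n) * s n + a n * b n + c n" by (rule rec)
    also have "\<dots> \<le> (1 - a n) * (d + ?E + ?S) + a n * d + c n"
      using step N1[of n] a[of n] by (intro add_mono mult_left_mono) (auto simp: N_def)
    also have "\<dots> = d + (1 - a n) * ?E + (1 - a n) * ?S + c n"
      by (simp add: algebra_simps)
    also have "\<dots> \<le> d + exp (- a n) * ?E + ?S + c n" using E S by linarith
    also have "exp (- a n) * ?E = exp (- (\<Sum>k=N..<Suc n. a k)) * s N"
      using step(1) by (simp add: exp_add[symmetric] mult.assoc[symmetric])
    finally show ?case using step(1) by simp
  qed
  \<comment> \<open>Removing the finitely many terms before \<open>N\<close> does not affect
    divergence.\<close>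
  have "filterlim (\<lambda>n. - (\<Sum>k<N. a k) + (\<Sum>k<n. a k)) at_top sequentially"
    by (rule filterlim_tendsto_add_at_top[OF tendsto_const div])
  moreover have "eventually (\<lambda>n. - (\<Sum>k<N. a k) + (\<Sum>k<n. a k) = (\<Sum>k=N..<n. a k)) sequentially"
    using eventually_ge_at_top[of N]
  proof eventually_elim
    case (elim n)
    then show ?case
      using sum.atLeastLessThan_concat[of 0 N n a] by (simp add: atLeast0LessThan)
  qed
  ultimately have "filterlim (\<lambda>n. \<Sum>k=N..<n. a k) at_top sequentially"
    by (rule filterlim_cong[OF refl refl, THEN iffD1, rotated])
  then have "(\<lambda>n. exp (- (\<Sum>k=N..<n. a k)) * s N) \<longlonglongrightarrow> 0 * s N"
    by (intro tendsto_mult tendsto_const filterlim_compose[OF exp_at_bot]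
        filterlim_compose[OF filterlim_uminus_at_bot_at_top])
  then have "eventually (\<lambda>n. exp (- (\<Sum>k=N..<n. a k)) * s N < d) sequentially"
    using d by (intro order_tendstoD) auto
  then have "eventually (\<lambda>n. norm (s n - 0) < e) sequentially"
    using eventually_ge_at_top[of N]
  proof eventually_elim
    case (elim n)
    have "(\<Sum>k=N..<n. c k) < d" using N2[of N n] by (simp add: N_def)
    then show ?case using bound[OF elim(2)] elim(1) s[of n] d by (simp add: d_def)
  qed
  then show "\<exists>no. \<forall>n\<ge>no. norm (s n - 0) < e" by (simp add: eventually_sequentially)
qed

section \<open>Almost fixed points closest to the anchor\<close>

text \<open>Both endpoints are within \<open>dist x y / 2 + d\<close> of \<open>T m\<close>. In the
  CN inequality at \<open>m\<close> with reference point \<open>T m\<close>, the term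
  \<open>(dist x y)\<^sup>2 / 4\<close> cancels and only terms containing \<open>d\<close>
  survive.\<close>

lemma midpoint_almost_fixed:
  fixes x y :: "'a::cat0_space"
  assumes "nonexpansive_on C T" "x \<in> C" "y \<in> C" and "geodesic_comb (1/2) x y \<in> C"
    and d: "dist x (T x) \<le> d" "dist y (T y) \<le> d"
  defines "m \<equiv> geodesic_comb (1/2) x y"
  shows "(dist m (T m))\<^sup>2 \<le> d * dist x y + d\<^sup>2"
proof -
  have mx: "dist x m = dist x y / 2" "dist y m = dist x y / 2"
    by (simp_all add: m_def dist_geodesic_comb_left dist_geodesic_comb_right)
  have "dist (T x) (T m) \<le> dist x m" "dist (T y) (T m) \<le> dist y m"
    using assms by (auto simp: nonexpansive_on_def)
  then have "dist x (T m) \<le> dist x y / 2 + d" "dist y (T m) \<le> dist x y / 2 + d"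
    using d mx dist_triangle[of x "T m" "T x"] dist_triangle[of y "T m" "T y"] by linarith+
  then have "(dist x (T m))\<^sup>2 \<le> (dist x y / 2 + d)\<^sup>2" "(dist y (T m))\<^sup>2 \<le> (dist x y / 2 + d)\<^sup>2"
    by (auto intro: power_mono)
  then show ?thesis
    using cn_inequality[of "1/2" x y "T m"]
    by (simp add: m_def[symmetric] power2_eq_square algebra_simps)
qed

text \<open>The limit \<open>z\<close> may lie outside \<open>C\<close>, so in place of
  \<open>T z = z\<close> the first conclusion says that \<open>T\<close> moves no point of
  \<open>C\<close> away from \<open>z\<close>. The second is the asymptotic minimality of
  \<open>z\<close> among almost fixed points; the bound \<open>M\<close> makes the midpoint estimate
  uniform.\<close>

lemma almost_fixed_minimiser:
  fixes C :: "'a::{cat0_space, complete_space} set"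
  assumes conv: "geodesically_convex C" and ne: "nonexpansive_on C T"
    and p: "p \<in> C" "T p = p" and M: "0 \<le> M"
  obtains z where "\<And>x. x \<in> C \<Longrightarrow> dist (T x) z \<le> dist x z"
    and "\<And>e. 0 < e \<Longrightarrow> \<exists>\<delta>>0. \<forall>x\<in>C. dist x p \<le> M \<longrightarrow> dist x (T x) \<le> \<delta> \<longrightarrow>
           (dist u z)\<^sup>2 - e \<le> (dist u x)\<^sup>2"
proof -
  define F where "F \<delta> = {x\<in>C. dist x p \<le> M \<and> dist x (T x) \<le> \<delta>}" for \<delta>
  \<comment> \<open>Shrinking \<open>\<delta>\<close> shrinks \<open>F \<delta>\<close> and raises
    \<open>f \<delta>\<close>, so the supremum \<open>r\<close> is the limit as
    \<open>\<delta>\<close> tends to 0. It is finite because \<open>p\<close> lies in every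
    \<open>F \<delta>\<close>.\<close>
  define f where "f \<delta> = (INF x\<in>F \<delta>. (dist u x)\<^sup>2)" for \<delta>
  define r where "r = (SUP \<delta>\<in>{0<..}. f \<delta>)"
  have pF: "p \<in> F \<delta>" if "\<delta> > 0" for \<delta> using p M that by (simp add: F_def)
  have bb: "bdd_below ((\<lambda>x. (dist u x)\<^sup>2) ` F \<delta>)" for \<delta> by (rule bdd_belowI2[of _ 0]) simp
  have f_le: "f \<delta> \<le> (dist u x)\<^sup>2" if "x \<in> F \<delta>" for x \<delta>
    unfolding f_def using bb that by (rule cINF_lower)
  have ba: "bdd_above (f ` {0<..})"
    by (rule bdd_aboveI2[of _ _ "(dist u p)\<^sup>2"]) (use f_le pF in auto)
  have low: "\<exists>\<delta>>0. \<forall>x\<in>F \<delta>. r - e \<le> (dist u x)\<^sup>2" if "e > 0" for e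
  proof -
    have "r - e < (SUP \<delta>\<in>{0<..}. f \<delta>)" using that by (simp add: r_def)
    then obtain \<delta> where "\<delta> > 0" "r - e < f \<delta>"
      using less_cSUP_iff[OF _ ba] by (auto simp: greaterThan_non_empty)
    then show ?thesis using f_le by (intro exI[of _ \<delta>]) (auto intro: less_imp_le order_trans)
  qed
  have "\<exists>x\<in>F \<delta>. (dist u x)\<^sup>2 < r + \<delta>" if "\<delta> > 0" for \<delta>
  proof -
    have "f \<delta> \<le> r" unfolding r_def using ba that by (intro cSUP_upper) auto
    then have "(INF x\<in>F \<delta>. (dist u x)\<^sup>2) < r + \<delta>" using that unfolding f_def by linarith
    then show ?thesis using cINF_less_iff[OF _ bb] pF[OF that] by blast
  qed
  then have "\<exists>x. x \<in> F (1 / real (Suc n)) \<and> (dist u x)\<^sup>2 < r + 1 / real (Suc n)" for n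
    by (meson divide_pos_pos of_nat_0_less_iff zero_less_Suc zero_less_one)
  then obtain y where y: "\<And>n. y n \<in> F (1 / real (Suc n))"
    and y_r: "\<And>n. (dist u (y n))\<^sup>2 < r + 1 / real (Suc n)"
    by metis
  have yC: "y n \<in> C" for n using y by (auto simp: F_def)
  have yM: "dist (y n) p \<le> M" for n using y by (auto simp: F_def)
  have yT: "dist (y n) (T (y n)) \<le> 1 / real (Suc n)" for n using y by (auto simp: F_def)
  have null: "(\<lambda>n. 1 / real (Suc n)) \<longlonglongrightarrow> 0" by (rule LIMSEQ_Suc[OF lim_1_over_n])
  \<comment> \<open>Two late terms have an almost fixed midpoint, which by minimality is not much closer to
      \<open>u\<close> than they are; the CN inequality then forces them to be close to each other.\<close>
  have "Cauchy y"
  proof (rule metric_CauchyI)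
    fix e :: real assume "e > 0"
    \<comment> \<open>The CN inequality at the midpoint will give
      \<open>(dist (y i) (y j))\<^sup>2 / 4 < (r + h) - (r - h)\<close>, that is, a squared distance
      below \<open>8 * h = e\<^sup>2\<close>.\<close>
    define h where "h = e\<^sup>2 / 8"
    have h: "h > 0" using \<open>e > 0\<close> by (simp add: h_def)
    obtain \<delta> where \<delta>: "\<delta> > 0" "\<And>x. x \<in> F \<delta> \<Longrightarrow> r - h \<le> (dist u x)\<^sup>2" using low[OF h] by auto
    \<comment> \<open>This is the bound of \<open>midpoint_almost_fixed\<close>, with
      \<open>2 * M\<close> for the distance of two points of the ball of radius \<open>M\<close>
      around \<open>p\<close>.\<close>
    have "(\<lambda>n. 1 / real (Suc n) * (2 * M) + (1 / real (Suc n))\<^sup>2) \<longlonglongrightarrow> 0 * (2 * M) + 0\<^sup>2"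
      by (intro tendsto_intros null)
    then have "eventually (\<lambda>n. 1 / real (Suc n) * (2 * M) + (1 / real (Suc n))\<^sup>2 < \<delta>\<^sup>2) sequentially"
      using \<delta>(1) by (intro order_tendstoD) auto
    moreover have "eventually (\<lambda>n. 1 / real (Suc n) < h) sequentially"
      using null h by (rule order_tendstoD)
    ultimately have "eventually (\<lambda>n. 1 / real (Suc n) * (2 * M) + (1 / real (Suc n))\<^sup>2 < \<delta>\<^sup>2 \<and>
        1 / real (Suc n) < h) sequentially"
      by eventually_elim simp
    then obtain N where N: "1 / real (Suc N) * (2 * M) + (1 / real (Suc N))\<^sup>2 < \<delta>\<^sup>2"
        "1 / real (Suc N) < h"
      by (auto simp: eventually_sequentially)
    have "dist (y i) (y j) < e" if "i \<ge> N" "j \<ge> N" for i j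
    proof -
      let ?m = "geodesic_comb (1/2) (y i) (y j)"
      have le: "1 / real (Suc i) \<le> 1 / real (Suc N)" "1 / real (Suc j) \<le> 1 / real (Suc N)"
        using that by (simp_all add: frac_le)
      have mC: "?m \<in> C" using conv yC by (auto simp: geodesically_convex_def)
      have "(dist ?m (T ?m))\<^sup>2 \<le> 1 / real (Suc N) * dist (y i) (y j) + (1 / real (Suc N))\<^sup>2"
        using yT[of i] yT[of j] le by (intro midpoint_almost_fixed[OF ne yC yC mC]) auto
      also have "\<dots> \<le> 1 / real (Suc N) * (2 * M) + (1 / real (Suc N))\<^sup>2"
        using yM[of i] yM[of j] dist_triangle2[of "y i" "y j" p]
        by (intro add_right_mono mult_left_mono) auto
      also have "\<dots> \<le> \<delta>\<^sup>2" using N by simp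
      finally have "dist ?m (T ?m) \<le> \<delta>" by (rule power2_le_imp_le) (use \<delta> in simp)
      moreover have "dist ?m p \<le> M"
        using dist_geodesic_comb_point_le[of "1/2" "y i" "y j" p] yM[of i] yM[of j] by simp
      ultimately have "r - h \<le> (dist u ?m)\<^sup>2" using mC by (intro \<delta>) (simp add: F_def)
      moreover have "(dist u (y i))\<^sup>2 < r + h" "(dist u (y j))\<^sup>2 < r + h"
        using y_r[of i] y_r[of j] le N by linarith+
      ultimately have "(dist (y i) (y j))\<^sup>2 < e\<^sup>2"
        using cn_inequality[of "1/2" "y i" "y j" u] by (simp add: h_def dist_commute)
      then show ?thesis using \<open>e > 0\<close> by (simp add: power2_less_imp_less)
    qed
    then show "\<exists>N. \<forall>i\<ge>N. \<forall>j\<ge>N. dist (y i) (y j) < e" by blast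
  qed
  then obtain z where z: "y \<longlonglongrightarrow> z" by (auto simp: Cauchy_convergent_iff convergent_def)
  show ?thesis
  proof
    fix x assume x: "x \<in> C"
    \<comment> \<open>The almost fixed \<open>y n\<close> takes the place of \<open>T (y n)\<close>
      at the cost of an error that vanishes in the limit; \<open>T\<close> is never evaluated at
      \<open>z\<close>.\<close>
    have "dist (T x) (y n) \<le> dist x (y n) + 1 / real (Suc n)" for n
    proof -
      have "dist (T x) (T (y n)) \<le> dist x (y n)" using ne x yC by (auto simp: nonexpansive_on_def)
      then show ?thesis using yT[of n] dist_triangle2[of "T x" "y n" "T (y n)"] by linarith
    qed
    moreover have "(\<lambda>n. dist x (y n) + 1 / real (Suc n)) \<longlonglongrightarrow> dist x z + 0"
      by (intro tendsto_intros z null)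
    moreover have "(\<lambda>n. dist (T x) (y n)) \<longlonglongrightarrow> dist (T x) z"
      by (intro tendsto_intros z)
    ultimately show "dist (T x) z \<le> dist x z"
      using LIMSEQ_le[of "\<lambda>n. dist (T x) (y n)"] by fastforce
  next
    fix e :: real assume "e > 0"
    have "(dist u z)\<^sup>2 \<le> r + 0"
    proof (rule LIMSEQ_le)
      show "(\<lambda>n. (dist u (y n))\<^sup>2) \<longlonglongrightarrow> (dist u z)\<^sup>2" by (intro tendsto_intros z)
      show "(\<lambda>n. r + 1 / real (Suc n)) \<longlonglongrightarrow> r + 0" by (intro tendsto_intros null)
    qed (use y_r less_imp_le in blast)
    then show "\<exists>\<delta>>0. \<forall>x\<in>C. dist x p \<le> M \<longrightarrow> dist x (T x) \<le> \<delta> \<longrightarrow> (dist u z)\<^sup>2 - e \<le> (dist u x)\<^sup>2"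
      using low[OF \<open>e > 0\<close>] by (fastforce simp: F_def)
  qed
qed

theorem mainTheorem9:
  fixes C :: "'a::{cat0_space, complete_space} set"
    and T :: "'a \<Rightarrow> 'a"
    and u x0 :: 'a
    and \<beta> \<mu> :: "nat \<Rightarrow> real"
  assumes "geodesically_convex C"
    and "T \<in> C \<rightarrow> C"
    and "nonexpansive_on C T"
    and "\<exists>p\<in>C. T p = p"
    and "u \<in> C" and "x0 \<in> C"
    and "\<And>n. \<beta> n \<in> {0..1}" and "\<And>n. \<mu> n \<in> {0..1}"
    and "filterlim (\<lambda>N. \<Sum>n<N. 1 - \<beta> n) at_top sequentially"
    and "summable (\<lambda>n. \<bar>\<beta> (Suc n) - \<beta> n\<bar>)"
    and "summable (\<lambda>n. \<bar>\<mu> (Suc n) - \<mu> n\<bar>)"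
    and "\<beta> \<longlonglongrightarrow> 1"
    and "liminf (\<lambda>n. ereal (\<mu> n)) > 0"
  shows "convergent (tikhonov_mann T u x0 \<beta> \<mu>)"
proof -
  define x where "x = tikhonov_mann T u x0 \<beta> \<mu>"
  define v where "v n = geodesic_comb (\<beta> n) u (x n)" for n
  note \<beta> = assms(7) and \<mu> = assms(8) and ne = assms(3)
  have x_Suc: "x (Suc n) = geodesic_comb (\<mu> n) (v n) (T (v n))" for n
    by (simp add: x_def v_def Let_def)
  have comb_mem: "geodesic_comb t a b \<in> C" if "a \<in> C" "b \<in> C" "t \<in> {0..1}" for t a b
    using assms(1) that by (auto simp: geodesically_convex_def)
  have TC: "T a \<in> C" if "a \<in> C" for a using assms(2) that by auto
  have T_le: "dist (T a) (T b) \<le> dist a b" if "a \<in> C" "b \<in> C" for a b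
    using ne that by (simp add: nonexpansive_on_def)
  have xC: "x n \<in> C" for n
  proof (induction n)
    case 0
    then show ?case using assms(6) by (simp add: x_def)
  next
    case (Suc n)
    then show ?case using assms(5) \<beta> \<mu> unfolding x_Suc v_def by (intro comb_mem TC) auto
  qed
  have vC: "v n \<in> C" for n unfolding v_def using assms(5) xC \<beta> by (intro comb_mem)

  \<comment> \<open>Boundedness of the iteration\<close>
  obtain p where p: "p \<in> C" "T p = p" using assms(4) by blast
  \<comment> \<open>The ball of radius \<open>M\<close> around \<open>p\<close> contains
    \<open>u\<close> and \<open>x0\<close>, and both averaging steps stay inside it.\<close>
  define M where "M = max (dist u p) (dist x0 p)"
  have M0: "0 \<le> M" by (simp add: M_def max.coboundedI1)
  have uM: "dist u p \<le> M" by (simp add: M_def)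
  \<comment> \<open>Stated for a general \<open>w\<close> because it serves twice: for the fixed
    point \<open>p\<close>, and for the later limit \<open>z\<close>, which may lie outside
    \<open>C\<close>.\<close>
  have x_Suc_le: "dist (x (Suc n)) w \<le> dist (v n) w" if "dist (T (v n)) w \<le> dist (v n) w" for n w
  proof -
    have "dist (x (Suc n)) w \<le> (1 - \<mu> n) * dist (v n) w + \<mu> n * dist (T (v n)) w"
      unfolding x_Suc by (rule dist_geodesic_comb_point_le[OF \<mu>])
    also have "\<dots> \<le> (1 - \<mu> n) * dist (v n) w + \<mu> n * dist (v n) w"
      using that \<mu>[of n] by (intro add_left_mono mult_left_mono) auto
    also have "\<dots> = dist (v n) w" by (simp add: algebra_simps)
    finally show ?thesis .
  qed
  have vM_step: "dist (v n) p \<le> M" if "dist (x n) p \<le> M" for n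
  proof -
    have "dist (v n) p \<le> (1 - \<beta> n) * dist u p + \<beta> n * dist (x n) p"
      unfolding v_def by (rule dist_geodesic_comb_point_le[OF \<beta>])
    also have "\<dots> \<le> (1 - \<beta> n) * M + \<beta> n * M"
      using that uM \<beta>[of n] by (intro add_mono mult_left_mono) auto
    also have "\<dots> = M" by (simp add: algebra_simps)
    finally show ?thesis .
  qed
  have xM: "dist (x n) p \<le> M" for n
  proof (induction n)
    case 0
    then show ?case by (simp add: x_def M_def)
  next
    case (Suc n)
    have "dist (x (Suc n)) p \<le> dist (v n) p"
      using T_le[OF vC[of n] p(1)] p(2) by (intro x_Suc_le) simp
    then show ?case using vM_step[OF Suc] by linarith
  qed
  have vM: "dist (v n) p \<le> M" for n using vM_step xM .
  have ux: "dist u (x n) \<le> 2 * M" for n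
    using dist_triangle2[of u "x n" p] uM xM[of n] by linarith
  have vT: "dist (v n) (T (v n)) \<le> 2 * M" for n
    using dist_triangle2[of "v n" "T (v n)" p] T_le[OF vC[of n] p(1)] p(2) vM[of n] by simp

  \<comment> \<open>Asymptotic regularity\<close>
  have "(\<lambda>n. dist (x (Suc n)) (x n)) \<longlonglongrightarrow> 0"
  \<comment> \<open>Passing from \<open>x (Suc n)\<close> to \<open>x (Suc (Suc n))\<close> uses
    \<open>\<beta> (Suc n)\<close>, hence the shifted index in \<open>a\<close>. The summable error
    \<open>c\<close> is the cost of changing the parameters.\<close>
  proof (rule xu_recursive_inequality[where a = "\<lambda>n. 1 - \<beta> (Suc n)" and b = "\<lambda>_. 0"
        and c = "\<lambda>n. 2 * M * (\<bar>\<beta> (Suc n) - \<beta> n\<bar> + \<bar>\<mu> (Suc n) - \<mu> n\<bar>)"])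
    fix n
    show "dist (x (Suc (Suc n))) (x (Suc n)) \<le> (1 - (1 - \<beta> (Suc n))) * dist (x (Suc n)) (x n)
        + (1 - \<beta> (Suc n)) * 0 + 2 * M * (\<bar>\<beta> (Suc n) - \<beta> n\<bar> + \<bar>\<mu> (Suc n) - \<mu> n\<bar>)"
    proof -
      have "dist (v (Suc n)) (geodesic_comb (\<beta> (Suc n)) u (x n)) \<le> \<beta> (Suc n) * dist (x (Suc n)) (x n)"
        unfolding v_def by (rule dist_geodesic_comb_right_le[OF \<beta>])
      moreover have "dist (geodesic_comb (\<beta> (Suc n)) u (x n)) (v n) \<le> \<bar>\<beta> (Suc n) - \<beta> n\<bar> * dist u (x n)"
        unfolding v_def by (rule dist_geodesic_comb_param_le[OF \<beta> \<beta>])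
      moreover have "\<bar>\<beta> (Suc n) - \<beta> n\<bar> * dist u (x n) \<le> \<bar>\<beta> (Suc n) - \<beta> n\<bar> * (2 * M)"
        using ux by (intro mult_left_mono) auto
      ultimately have v: "dist (v (Suc n)) (v n) \<le>
          \<beta> (Suc n) * dist (x (Suc n)) (x n) + \<bar>\<beta> (Suc n) - \<beta> n\<bar> * (2 * M)"
        using dist_triangle[of "v (Suc n)" "v n" "geodesic_comb (\<beta> (Suc n)) u (x n)"] by linarith
      \<comment> \<open>New parameter, old endpoints: this separates the change of the points from
        that of \<open>\<mu>\<close>.\<close>
      let ?w = "geodesic_comb (\<mu> (Suc n)) (v n) (T (v n))"
      have "dist (x (Suc (Suc n))) ?w \<le>
          (1 - \<mu> (Suc n)) * dist (v (Suc n)) (v n) + \<mu> (Suc n) * dist (T (v (Suc n))) (T (v n))"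
        unfolding x_Suc by (rule dist_geodesic_comb_le[OF \<mu>])
      also have "\<dots> \<le> (1 - \<mu> (Suc n)) * dist (v (Suc n)) (v n) + \<mu> (Suc n) * dist (v (Suc n)) (v n)"
        using \<mu>[of "Suc n"] T_le vC by (intro add_left_mono mult_left_mono) auto
      also have "\<dots> = dist (v (Suc n)) (v n)" by (simp add: algebra_simps)
      finally have "dist (x (Suc (Suc n))) ?w \<le> dist (v (Suc n)) (v n)" .
      moreover have "dist ?w (x (Suc n)) \<le> \<bar>\<mu> (Suc n) - \<mu> n\<bar> * dist (v n) (T (v n))"
        unfolding x_Suc by (rule dist_geodesic_comb_param_le[OF \<mu> \<mu>])
      moreover have "\<bar>\<mu> (Suc n) - \<mu> n\<bar> * dist (v n) (T (v n)) \<le> \<bar>\<mu> (Suc n) - \<mu> n\<bar> * (2 * M)"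
        using vT by (intro mult_left_mono) auto
      ultimately show ?thesis
        using v dist_triangle[of "x (Suc (Suc n))" "x (Suc n)" ?w] by (simp add: algebra_simps)
    qed
    show "1 - \<beta> (Suc n) \<in> {0..1}" using \<beta>[of "Suc n"] by simp
  next
    \<comment> \<open>The constant \<open>\<beta> 0 - 1\<close> cancels the first term, which leaves
      the shifted sum.\<close>
    have "filterlim (\<lambda>N. (\<beta> 0 - 1) + (\<Sum>n<Suc N. 1 - \<beta> n)) at_top sequentially"
      by (intro filterlim_tendsto_add_at_top[OF tendsto_const] filterlim_compose[OF assms(9) filterlim_Suc])
    then show "filterlim (\<lambda>N. \<Sum>n<N. 1 - \<beta> (Suc n)) at_top sequentially"
      by (simp add: sum.lessThan_Suc_shift del: sum.lessThan_Suc)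
    show "summable (\<lambda>n. 2 * M * (\<bar>\<beta> (Suc n) - \<beta> n\<bar> + \<bar>\<mu> (Suc n) - \<mu> n\<bar>))"
      using assms(10,11) by (intro summable_mult summable_add)
  qed (use M0 in auto)
  moreover have "(\<lambda>n. dist (x n) (v n)) \<longlonglongrightarrow> 0"
  proof (rule tendsto_sandwich)
    have "dist (x n) (v n) \<le> (1 - \<beta> n) * (2 * M)" for n
      using \<beta>[of n] ux unfolding v_def dist_geodesic_comb_right[OF \<beta>]
      by (intro mult_left_mono) auto
    then show "eventually (\<lambda>n. dist (x n) (v n) \<le> (1 - \<beta> n) * (2 * M)) sequentially"
      by simp
    show "eventually (\<lambda>n. 0 \<le> dist (x n) (v n)) sequentially" by simp
    have "(\<lambda>n. (1 - \<beta> n) * (2 * M)) \<longlonglongrightarrow> (1 - 1) * (2 * M)"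
      by (intro tendsto_intros assms(12))
    then show "(\<lambda>n. (1 - \<beta> n) * (2 * M)) \<longlonglongrightarrow> 0" by simp
  qed auto
  ultimately have sum0: "(\<lambda>n. dist (x (Suc n)) (x n) + dist (x n) (v n)) \<longlonglongrightarrow> 0"
    using tendsto_add_zero by blast
  obtain c where c: "c > 0" "eventually (\<lambda>n. c < \<mu> n) sequentially"
  proof -
    obtain c where "0 < ereal c" "ereal c < liminf (\<lambda>n. ereal (\<mu> n))"
      using ereal_dense2[OF assms(13)] by blast
    then show ?thesis using that[of c] less_LiminfD by fastforce
  qed
  \<comment> \<open>The step from \<open>v n\<close> to \<open>x (Suc n)\<close> has length
    \<open>\<mu> n * dist (v n) (T (v n))\<close>, so a bound on it can be divided by the eventual
    lower bound \<open>c\<close>.\<close>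
  have vT0: "(\<lambda>n. dist (v n) (T (v n))) \<longlonglongrightarrow> 0"
  proof (rule tendsto_sandwich)
    show "eventually (\<lambda>n. 0 \<le> dist (v n) (T (v n))) sequentially" by simp
    show "eventually (\<lambda>n. dist (v n) (T (v n)) \<le>
        (dist (x (Suc n)) (x n) + dist (x n) (v n)) / c) sequentially"
      using c(2)
    proof eventually_elim
      case (elim n)
      have "c * dist (v n) (T (v n)) \<le> \<mu> n * dist (v n) (T (v n))"
        using elim by (intro mult_right_mono) auto
      also have "\<dots> = dist (v n) (x (Suc n))"
        unfolding x_Suc by (simp add: dist_geodesic_comb_left[OF \<mu>])
      also have "\<dots> \<le> dist (x (Suc n)) (x n) + dist (x n) (v n)"
        using dist_triangle[of "x (Suc n)" "v n" "x n"] by (simp add: dist_commute)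
      finally show ?case using c(1) by (simp add: field_simps)
    qed
    show "(\<lambda>n. (dist (x (Suc n)) (x n) + dist (x n) (v n)) / c) \<longlonglongrightarrow> 0"
      using tendsto_divide_zero[OF sum0] .
  qed auto

  \<comment> \<open>Strong convergence\<close>
  obtain z where z: "\<And>x. x \<in> C \<Longrightarrow> dist (T x) z \<le> dist x z"
    and z_min: "\<And>e. 0 < e \<Longrightarrow> \<exists>\<delta>>0. \<forall>x\<in>C. dist x p \<le> M \<longrightarrow> dist x (T x) \<le> \<delta> \<longrightarrow>
           (dist u z)\<^sup>2 - e \<le> (dist u x)\<^sup>2"
    using almost_fixed_minimiser[OF assms(1) ne p M0] by metis
  have "(\<lambda>n. (dist (x n) z)\<^sup>2) \<longlonglongrightarrow> 0"
  proof (rule xu_recursive_inequality[where a = "\<lambda>n. 1 - \<beta> n" and c = "\<lambda>_. 0"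
        and b = "\<lambda>n. (dist u z)\<^sup>2 - \<beta> n * (dist u (x n))\<^sup>2"])
    fix n
    have "(dist (x (Suc n)) z)\<^sup>2 \<le> (dist (v n) z)\<^sup>2"
      using x_Suc_le z vC by (intro power_mono) auto
    also have "\<dots> \<le> (1 - \<beta> n) * (dist u z)\<^sup>2 + \<beta> n * (dist (x n) z)\<^sup>2
        - \<beta> n * (1 - \<beta> n) * (dist u (x n))\<^sup>2"
      unfolding v_def by (rule cn_inequality[OF \<beta>])
    finally show "(dist (x (Suc n)) z)\<^sup>2 \<le> (1 - (1 - \<beta> n)) * (dist (x n) z)\<^sup>2
        + (1 - \<beta> n) * ((dist u z)\<^sup>2 - \<beta> n * (dist u (x n))\<^sup>2) + 0"
      by (simp add: algebra_simps)
    show "1 - \<beta> n \<in> {0..1}" using \<beta>[of n] by simp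
  next
    fix e :: real assume "e > 0"
    then obtain \<delta> where \<delta>: "\<delta> > 0" "\<And>x. x \<in> C \<Longrightarrow> dist x p \<le> M \<Longrightarrow> dist x (T x) \<le> \<delta> \<Longrightarrow>
        (dist u z)\<^sup>2 - e \<le> (dist u x)\<^sup>2"
      using z_min by blast
    show "eventually (\<lambda>n. (dist u z)\<^sup>2 - \<beta> n * (dist u (x n))\<^sup>2 \<le> e) sequentially"
      using order_tendstoD(2)[OF vT0 \<delta>(1)]
    proof eventually_elim
      case (elim n)
      \<comment> \<open>Minimality of \<open>z\<close> applies to \<open>v n\<close>, the sequence
        known to be almost fixed; \<open>\<beta> n * \<beta> n \<le> \<beta> n\<close> carries it
        over to \<open>x n\<close>.\<close>
      have "(dist u (v n))\<^sup>2 = (\<beta> n * \<beta> n) * (dist u (x n))\<^sup>2"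
        unfolding v_def by (simp add: dist_geodesic_comb_left[OF \<beta>] power2_eq_square)
      also have "\<dots> \<le> \<beta> n * (dist u (x n))\<^sup>2"
        using \<beta>[of n] by (intro mult_right_mono mult_left_le_one_le) auto
      finally show ?case using \<delta>(2)[OF vC vM, of n] elim by linarith
    qed
  qed (use assms(9) in auto)
  then have "(\<lambda>n. dist (x n) z) \<longlonglongrightarrow> 0" using tendsto_real_sqrt by fastforce
  then have "x \<longlonglongrightarrow> z" by (rule tendsto_dist_iff[THEN iffD2])
  then show ?thesis by (auto simp: convergent_def x_def)
qed

end
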